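(* Let $\sigma$ be a vocabulary, $\mathcal{V}=\{V_1,\ldots,V_n\}$ a finite set of views over $\sigma$, and $\mathbf{A},\mathbf{B}$ finite $\sigma$-structures. Then the following are equivalent: (1) $\mathbf{A}$ and $\mathbf{B}$ satisfy the same sentences of $\mathrm{UCV}(\sigma,\mathcal{V})$; (2) $\Lambda(\mathbf{A})$ and $\Lambda(\mathbf{B})$ satisfy the same first-order sentences without equality over the unary vocabulary $\{V_1,\ldots,V_n\}$ of quantifier rank $1$.
   Context: A view over $\sigma$ is a unary conjunctive query without equality and without negation: $V(y)\equiv\exists x_1,\ldots,x_n\,(R_1(u_1)\wedge\cdots\wedge R_k(u_k))$ with exactly one free variable $y$, $R_i\in\sigma$, $u_i$ tuples of variables. $\mathrm{UCV}(\sigma,\mathcal{V})$ is the smallest set of formulas containing $V(x)$ for each $V\in\mathcal{V}$ and variable $x$, closed under $\neg$, $\wedge$, $\exists x$, interpreted over $\sigma$-structures by expanding view definitions. For a $\sigma$-structure $\mathbf{I}$ with universe $I$, $\Lambda(\mathbf{I})$ is the structure over the unary vocabulary $\{V_1,\ldots,V_n\}$ with universe $I$ in which each $V_i$ is interpreted as the set of elements of $\mathbf{I}$ satisfying the view $V_i$. Quantifier rank is the maximum nesting depth of quantifiers. *)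

theory Defs
  imports Main
begin

type_synonym 'r vocabulary = "'r \<rightharpoonup> nat"  \<comment> \<open>relation symbols with their arities\<close>

datatype 'r fo =
    Atom 'r "nat list"
  | Eq nat nat
  | Neg "'r fo"
  | Conj "'r fo" "'r fo"
  | Disj "'r fo" "'r fo"
  | Imp "'r fo" "'r fo"
  | Ex nat "'r fo"
  | All nat "'r fo"

fun fv :: "'r fo \<Rightarrow> nat set" where
  "fv (Atom R xs) = set xs"
| "fv (Eq x y) = {x, y}"
| "fv (Neg \<phi>) = fv \<phi>"
| "fv (Conj \<phi> \<psi>) = fv \<phi> \<union> fv \<psi>"
| "fv (Disj \<phi> \<psi>) = fv \<phi> \<union> fv \<psi>"
| "fv (Imp \<phi> \<psi>) = fv \<phi> \<union> fv \<psi>"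
| "fv (Ex x \<phi>) = fv \<phi> - {x}"
| "fv (All x \<phi>) = fv \<phi> - {x}"

definition sentence :: "'r fo \<Rightarrow> bool" where
  "sentence \<phi> \<longleftrightarrow> fv \<phi> = {}"

fun over :: "'r vocabulary \<Rightarrow> 'r fo \<Rightarrow> bool" where
  "over \<sigma> (Atom R xs) \<longleftrightarrow> \<sigma> R = Some (length xs)"
| "over \<sigma> (Eq x y) \<longleftrightarrow> True"
| "over \<sigma> (Neg \<phi>) \<longleftrightarrow> over \<sigma> \<phi>"
| "over \<sigma> (Conj \<phi> \<psi>) \<longleftrightarrow> over \<sigma> \<phi> \<and> over \<sigma> \<psi>"
| "over \<sigma> (Disj \<phi> \<psi>) \<longleftrightarrow> over \<sigma> \<phi> \<and> over \<sigma> \<psi>"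
| "over \<sigma> (Imp \<phi> \<psi>) \<longleftrightarrow> over \<sigma> \<phi> \<and> over \<sigma> \<psi>"
| "over \<sigma> (Ex x \<phi>) \<longleftrightarrow> over \<sigma> \<phi>"
| "over \<sigma> (All x \<phi>) \<longleftrightarrow> over \<sigma> \<phi>"

fun equality_free :: "'r fo \<Rightarrow> bool" where
  "equality_free (Atom R xs) \<longleftrightarrow> True"
| "equality_free (Eq x y) \<longleftrightarrow> False"
| "equality_free (Neg \<phi>) \<longleftrightarrow> equality_free \<phi>"
| "equality_free (Conj \<phi> \<psi>) \<longleftrightarrow> equality_free \<phi> \<and> equality_free \<psi>"
| "equality_free (Disj \<phi> \<psi>) \<longleftrightarrow> equality_free \<phi> \<and> equality_free \<psi>"
| "equality_free (Imp \<phi> \<psi>) \<longleftrightarrow> equality_free \<phi> \<and> equality_free \<psi>"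
| "equality_free (Ex x \<phi>) \<longleftrightarrow> equality_free \<phi>"
| "equality_free (All x \<phi>) \<longleftrightarrow> equality_free \<phi>"

fun quantifier_rank :: "'r fo \<Rightarrow> nat" where
  "quantifier_rank (Atom R xs) = 0"
| "quantifier_rank (Eq x y) = 0"
| "quantifier_rank (Neg \<phi>) = quantifier_rank \<phi>"
| "quantifier_rank (Conj \<phi> \<psi>) = max (quantifier_rank \<phi>) (quantifier_rank \<psi>)"
| "quantifier_rank (Disj \<phi> \<psi>) = max (quantifier_rank \<phi>) (quantifier_rank \<psi>)"
| "quantifier_rank (Imp \<phi> \<psi>) = max (quantifier_rank \<phi>) (quantifier_rank \<psi>)"
| "quantifier_rank (Ex x \<phi>) = Suc (quantifier_rank \<phi>)"
| "quantifier_rank (All x \<phi>) = Suc (quantifier_rank \<phi>)"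

record ('r, 'a) fo_structure =
  universe :: "'a set"
  interp :: "'r \<Rightarrow> 'a list set"

definition is_structure :: "'r vocabulary \<Rightarrow> ('r, 'a) fo_structure \<Rightarrow> bool" where
  "is_structure \<sigma> A \<longleftrightarrow> universe A \<noteq> {} \<and>
     (\<forall>R n. \<sigma> R = Some n \<longrightarrow>
        interp A R \<subseteq> {as. length as = n \<and> set as \<subseteq> universe A})"

fun sat :: "('r, 'a) fo_structure \<Rightarrow> (nat \<Rightarrow> 'a) \<Rightarrow> 'r fo \<Rightarrow> bool" where
  "sat A s (Atom R xs) \<longleftrightarrow> map s xs \<in> interp A R"
| "sat A s (Eq x y) \<longleftrightarrow> s x = s y"
| "sat A s (Neg \<phi>) \<longleftrightarrow> \<not> sat A s \<phi>"
| "sat A s (Conj \<phi> \<psi>) \<longleftrightarrow> sat A s \<phi> \<and> sat A s \<psi>"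
| "sat A s (Disj \<phi> \<psi>) \<longleftrightarrow> sat A s \<phi> \<or> sat A s \<psi>"
| "sat A s (Imp \<phi> \<psi>) \<longleftrightarrow> (sat A s \<phi> \<longrightarrow> sat A s \<psi>)"
| "sat A s (Ex x \<phi>) \<longleftrightarrow> (\<exists>a \<in> universe A. sat A (s(x := a)) \<phi>)"
| "sat A s (All x \<phi>) \<longleftrightarrow> (\<forall>a \<in> universe A. sat A (s(x := a)) \<phi>)"

definition models :: "('r, 'a) fo_structure \<Rightarrow> 'r fo \<Rightarrow> bool" where
  "models A \<phi> \<longleftrightarrow> (\<forall>s. range s \<subseteq> universe A \<longrightarrow> sat A s \<phi>)"

text \<open>
  \<open>View y [x\<^sub>1, \<dots>, x\<^sub>n] [(R\<^sub>1, u\<^sub>1), \<dots>, (R\<^sub>k, u\<^sub>k)]\<close> stands for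
  \<open>V(y) \<equiv> \<exists>x\<^sub>1, \<dots>, x\<^sub>n (R\<^sub>1(u\<^sub>1) \<and> \<dots> \<and> R\<^sub>k(u\<^sub>k))\<close>.
\<close>

datatype 'r view =
  View (head_var: nat) (bound_vars: "nat list") (body: "('r \<times> nat list) list")

text \<open>The empty conjunction is left unspecified; \<open>is_view\<close> excludes it.\<close>

fun conj_atoms :: "('r \<times> nat list) list \<Rightarrow> 'r fo" where
  "conj_atoms [(R, u)] = Atom R u"
| "conj_atoms ((R, u) # b # bs) = Conj (Atom R u) (conj_atoms (b # bs))"

definition view_formula :: "'r view \<Rightarrow> 'r fo" where
  "view_formula V = foldr Ex (bound_vars V) (conj_atoms (body V))"

definition is_view :: "'r vocabulary \<Rightarrow> 'r view \<Rightarrow> bool" where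
  "is_view \<sigma> V \<longleftrightarrow> body V \<noteq> [] \<and> over \<sigma> (view_formula V) \<and>
     fv (view_formula V) = {head_var V}"

text \<open>
  The formula \<open>V(x)\<close>: the head variable becomes \<open>x\<close>, while all other variables are
  renamed injectively to variables greater than \<open>x\<close>, so that \<open>x\<close> is not captured.
\<close>

definition view_renaming :: "'r view \<Rightarrow> nat \<Rightarrow> nat \<Rightarrow> nat" where
  "view_renaming V x z = (if z = head_var V then x else z + Suc x)"

definition view_at :: "'r view \<Rightarrow> nat \<Rightarrow> 'r fo" where
  "view_at V x = (let \<rho> = view_renaming V x in
     view_formula (View x (map \<rho> (bound_vars V)) (map (\<lambda>(R, u). (R, map \<rho> u)) (body V))))"

text \<open>The views themselves serve as the symbols of the unary vocabulary.\<close>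

definition view_vocabulary :: "'r view set \<Rightarrow> 'r view vocabulary" where
  "view_vocabulary \<V> = (\<lambda>V. if V \<in> \<V> then Some 1 else None)"

inductive_set UCV :: "'r view set \<Rightarrow> 'r view fo set" for \<V> where
  "V \<in> \<V> \<Longrightarrow> Atom V [x] \<in> UCV \<V>"
| "\<phi> \<in> UCV \<V> \<Longrightarrow> Neg \<phi> \<in> UCV \<V>"
| "\<phi> \<in> UCV \<V> \<Longrightarrow> \<psi> \<in> UCV \<V> \<Longrightarrow> Conj \<phi> \<psi> \<in> UCV \<V>"
| "\<phi> \<in> UCV \<V> \<Longrightarrow> Ex x \<phi> \<in> UCV \<V>"

text \<open>The argument list of every atom of a formula over a view vocabulary is a singleton.\<close>

fun expand :: "'r view fo \<Rightarrow> 'r fo" where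
  "expand (Atom V xs) = view_at V (hd xs)"
| "expand (Eq x y) = Eq x y"
| "expand (Neg \<phi>) = Neg (expand \<phi>)"
| "expand (Conj \<phi> \<psi>) = Conj (expand \<phi>) (expand \<psi>)"
| "expand (Disj \<phi> \<psi>) = Disj (expand \<phi>) (expand \<psi>)"
| "expand (Imp \<phi> \<psi>) = Imp (expand \<phi>) (expand \<psi>)"
| "expand (Ex x \<phi>) = Ex x (expand \<phi>)"
| "expand (All x \<phi>) = All x (expand \<phi>)"

text \<open>
  The head is the only free variable of a view, so the constant assignment \<open>\<lambda>_. a\<close> below
  just says that the head takes the value \<open>a\<close>.
\<close>

definition Lambda ::
  "'r view set \<Rightarrow> ('r, 'a) fo_structure \<Rightarrow> ('r view, 'a) fo_structure" where
  "Lambda \<V> A = \<lparr> universe = universe A,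
     interp = (\<lambda>V. if V \<in> \<V>
       then {[a] | a. a \<in> universe A \<and> sat A (\<lambda>_. a) (view_formula V)} else {}) \<rparr>"

end

theory Submission
  imports Defs
begin

text \<open>
  Call the set of views that hold at an element its type.  Both conditions are equivalent to
  \<open>A\<close> and \<open>B\<close> realizing the same types.  That a type is realized is expressed by a sentence
  \<open>\<exists>x. \<And>\<^sub>V (\<not>) V(x)\<close>, which is of rank 1 and lies in \<open>UCV\<close>.  Conversely, an equality-free
  formula cannot tell apart assignments with the same types, since a back-and-forth step only
  has to match the type of the new element, regardless of the elements chosen before.
\<close>

section \<open>Renaming of variables and expansion of views\<close>

lemma sat_cong_fv:
  "(\<And>x. x \<in> fv \<phi> \<Longrightarrow> s x = t x) \<Longrightarrow> sat A s \<phi> = sat A t \<phi>"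
proof (induction \<phi> arbitrary: s t)
  case (Atom R xs)
  then have "map s xs = map t xs" by simp
  then show ?case by (simp only: sat.simps)
next
  case (Ex x \<phi>)
  have "sat A (s(x := a)) \<phi> = sat A (t(x := a)) \<phi>" for a
    using Ex.prems by (intro Ex.IH) simp
  then show ?case by simp
next
  case (All x \<phi>)
  have "sat A (s(x := a)) \<phi> = sat A (t(x := a)) \<phi>" for a
    using All.prems by (intro All.IH) simp
  then show ?case by simp
next
  case (Conj \<phi> \<psi>)
  show ?case using Conj.IH[of s t] Conj.prems by simp
next
  case (Disj \<phi> \<psi>)
  show ?case using Disj.IH[of s t] Disj.prems by simp
next
  case (Imp \<phi> \<psi>)
  show ?case using Imp.IH[of s t] Imp.prems by simp
next
  case (Neg \<phi>)
  show ?case using Neg.IH[of s t] Neg.prems by simp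
qed simp

text \<open>\<open>conj_atoms []\<close> is an unspecified formula, so nothing relates its truth
  under \<open>s\<close> and \<open>s \<circ> \<rho>\<close>; hence the nonempty list.\<close>

lemma sat_conj_atoms_rename:
  "bs \<noteq> [] \<Longrightarrow> sat A s (conj_atoms (map (\<lambda>(R, u). (R, map \<rho> u)) bs)) = sat A (s \<circ> \<rho>) (conj_atoms bs)"
  by (induction bs rule: conj_atoms.induct) auto

text \<open>Injectivity gives \<open>(s(\<rho> x := a)) \<circ> \<rho> = (s \<circ> \<rho>)(x :=
  a)\<close>, so each quantifier passes through the renaming.\<close>

lemma sat_foldr_Ex_rename:
  assumes "inj \<rho>" and "\<And>s. sat A s \<phi>' = sat A (s \<circ> \<rho>) \<phi>"
  shows "sat A s (foldr Ex (map \<rho> xs) \<phi>') = sat A (s \<circ> \<rho>) (foldr Ex xs \<phi>)"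
proof (induction xs arbitrary: s)
  case Nil
  show ?case using assms(2) by (simp add: comp_def)
next
  case (Cons x xs)
  then show ?case using assms(1) by (simp add: comp_def fun_upd_def inj_eq)
qed

lemma inj_view_renaming: "inj (view_renaming V x)"
  by (rule injI) (auto simp: view_renaming_def split: if_splits)

lemma sat_view_at:
  assumes "is_view \<sigma> V"
  shows "sat A s (view_at V x) = sat A (\<lambda>_. s x) (view_formula V)"
proof -
  let ?\<rho> = "view_renaming V x"
  have "sat A s (view_at V x) = sat A (s \<circ> ?\<rho>) (view_formula V)"
    using assms unfolding view_at_def view_formula_def is_view_def Let_def view.sel
    by (intro sat_foldr_Ex_rename inj_view_renaming sat_conj_atoms_rename) simp
  \<comment> \<open>The head is the only free variable and is sent to \<open>x\<close>, so a
    constant assignment does as well; this is the form in which \<open>Lambda\<close> evaluates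
    views.\<close>
  also have "\<dots> = sat A (\<lambda>_. s x) (view_formula V)"
    using assms by (intro sat_cong_fv) (simp add: is_view_def view_renaming_def)
  finally show ?thesis .
qed

lemma universe_Lambda [simp]: "universe (Lambda \<V> A) = universe A"
  by (simp add: Lambda_def)

lemma interp_Lambda:
  "a \<in> universe A \<Longrightarrow>
    [a] \<in> interp (Lambda \<V> A) V \<longleftrightarrow> V \<in> \<V> \<and> sat A (\<lambda>_. a) (view_formula V)"
  by (simp add: Lambda_def)

text \<open>\<open>Lambda\<close> keeps only elements of the universe, which is why assignments are
  confined to it; the quantifier case preserves this.\<close>

lemma sat_expand:
  assumes "\<phi> \<in> UCV \<V>" and "\<forall>V \<in> \<V>. is_view \<sigma> V" and "range s \<subseteq> universe A"
  shows "sat A s (expand \<phi>) = sat (Lambda \<V> A) s \<phi>"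
  using assms(1,3)
proof (induction arbitrary: s)
  case (1 V x)
  then have "s x \<in> universe A" by auto
  with 1 show ?case using assms(2) sat_view_at[of \<sigma> V] by (simp add: interp_Lambda)
next
  case (4 \<phi> x)
  have "sat A (s(x := a)) (expand \<phi>) = sat (Lambda \<V> A) (s(x := a)) \<phi>" if "a \<in> universe A" for a
    using that 4 by (intro "4.IH") auto
  then show ?case by simp
qed auto

lemma UCV_over: "\<phi> \<in> UCV \<V> \<Longrightarrow> over (view_vocabulary \<V>) \<phi>"
  by (induction rule: UCV.induct) (auto simp: view_vocabulary_def)

lemma UCV_equality_free: "\<phi> \<in> UCV \<V> \<Longrightarrow> equality_free \<phi>"
  by (induction rule: UCV.induct) auto

section \<open>Preservation of equality-free formulas when the same types are realized\<close>

definition view_type :: "'r view set \<Rightarrow> ('r, 'a) fo_structure \<Rightarrow> 'a \<Rightarrow> 'r view set" where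
  "view_type \<V> A a = {V \<in> \<V>. sat A (\<lambda>_. a) (view_formula V)}"

lemma interp_Lambda_view_type:
  "a \<in> universe A \<Longrightarrow> [a] \<in> interp (Lambda \<V> A) V \<longleftrightarrow> V \<in> view_type \<V> A a"
  by (simp add: interp_Lambda view_type_def)

text \<open>The back-and-forth step in abstract form: equal images give every element of either set
  a partner in the other, and \<open>P\<close> and \<open>Q\<close> agree on partners.\<close>

lemma bex_ball_cong_image:
  assumes "f ` X = g ` Y" and PQ: "\<And>a b. a \<in> X \<Longrightarrow> b \<in> Y \<Longrightarrow> f a = g b \<Longrightarrow> P a = Q b"
  shows "(\<exists>a \<in> X. P a) \<longleftrightarrow> (\<exists>b \<in> Y. Q b)" and "(\<forall>a \<in> X. P a) \<longleftrightarrow> (\<forall>b \<in> Y. Q b)"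
proof -
  have "\<exists>b \<in> Y. P a = Q b" if a: "a \<in> X" for a
  proof -
    obtain b where "b \<in> Y" "f a = g b" using a assms(1) by blast
    with a PQ show ?thesis by metis
  qed
  moreover have "\<exists>a \<in> X. P a = Q b" if b: "b \<in> Y" for b
  proof -
    have "g b \<in> f ` X" using b assms(1) by simp
    then obtain a where "a \<in> X" "f a = g b" by force
    with b PQ show ?thesis by metis
  qed
  ultimately show "(\<exists>a \<in> X. P a) \<longleftrightarrow> (\<exists>b \<in> Y. Q b)" "(\<forall>a \<in> X. P a) \<longleftrightarrow> (\<forall>b \<in> Y. Q b)"
    by metis+
qed

text \<open>Types match at every variable, free or not, so updating both assignments with elements
  of equal type keeps the invariant. Matching types do not decide equalities between values, hence
  \<open>equality_free\<close>.\<close>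

lemma sat_Lambda_cong_view_type:
  assumes "over (view_vocabulary \<V>) \<phi>" and "equality_free \<phi>"
    and same: "view_type \<V> A ` universe A = view_type \<V> B ` universe B"
    and "range s \<subseteq> universe A" and "range t \<subseteq> universe B"
    and "\<And>x. view_type \<V> A (s x) = view_type \<V> B (t x)"
  shows "sat (Lambda \<V> A) s \<phi> = sat (Lambda \<V> B) t \<phi>"
  using assms(1,2,4-)
proof (induction \<phi> arbitrary: s t)
  case (Atom V xs)
  \<comment> \<open>Every symbol of the view vocabulary has arity 1.\<close>
  then obtain x where "xs = [x]"
    by (cases xs) (auto simp: view_vocabulary_def split: if_splits)
  moreover have "s x \<in> universe A" "t x \<in> universe B" using Atom.prems(3,4) by auto
  ultimately show ?case using Atom.prems(5) by (simp add: interp_Lambda_view_type)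
next
  case (Ex x \<phi>)
  have step: "sat (Lambda \<V> A) (s(x := a)) \<phi> = sat (Lambda \<V> B) (t(x := b)) \<phi>"
    if "a \<in> universe A" "b \<in> universe B" "view_type \<V> A a = view_type \<V> B b" for a b
    using that Ex.prems by (intro Ex.IH) auto
  from bex_ball_cong_image(1)[OF same step] show ?case by simp
next
  case (All x \<phi>)
  have step: "sat (Lambda \<V> A) (s(x := a)) \<phi> = sat (Lambda \<V> B) (t(x := b)) \<phi>"
    if "a \<in> universe A" "b \<in> universe B" "view_type \<V> A a = view_type \<V> B b" for a b
    using that All.prems by (intro All.IH) auto
  from bex_ball_cong_image(2)[OF same step] show ?case by simp
next
  case (Neg \<phi>)
  show ?case using Neg.IH[of s t] Neg.prems by simp
next
  case (Conj \<phi> \<psi>)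
  show ?case using Conj.IH[of s t] Conj.prems by simp
next
  case (Disj \<phi> \<psi>)
  show ?case using Disj.IH[of s t] Disj.prems by simp
next
  case (Imp \<phi> \<psi>)
  show ?case using Imp.IH[of s t] Imp.prems by simp
\<comment> \<open>The remaining case \<open>Eq\<close> contradicts
  \<open>equality_free\<close>.\<close>
qed simp

lemma models_Lambda_mono_view_type:
  assumes "over (view_vocabulary \<V>) \<phi>" and "equality_free \<phi>"
    and same: "view_type \<V> A ` universe A = view_type \<V> B ` universe B"
    and "models (Lambda \<V> A) \<phi>"
  shows "models (Lambda \<V> B) \<phi>"
  unfolding models_def
proof (intro allI impI)
  fix t :: "nat \<Rightarrow> _" assume "range t \<subseteq> universe (Lambda \<V> B)"
  then have t: "range t \<subseteq> universe B" by simp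
  \<comment> \<open>\<open>models\<close> ranges over all assignments, so \<open>t\<close> is pulled
    back, variable by variable, to an assignment into \<open>A\<close> with the same types.\<close>
  then have "\<forall>x. \<exists>a \<in> universe A. view_type \<V> A a = view_type \<V> B (t x)"
    using same by (metis imageE imageI range_subsetD)
  then obtain s where "\<And>x. s x \<in> universe A" "\<And>x. view_type \<V> A (s x) = view_type \<V> B (t x)"
    by metis
  moreover from this(1) have "range s \<subseteq> universe A" by auto
  ultimately have "sat (Lambda \<V> A) s \<phi> = sat (Lambda \<V> B) t \<phi>"
    using assms(1-3) t by (intro sat_Lambda_cong_view_type)
  with \<open>range s \<subseteq> universe A\<close> assms(4) show "sat (Lambda \<V> B) t \<phi>"
    by (simp add: models_def)
qed

lemma models_Lambda_cong_view_type:
  assumes "over (view_vocabulary \<V>) \<phi>" and "equality_free \<phi>"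
    and "view_type \<V> A ` universe A = view_type \<V> B ` universe B"
  shows "models (Lambda \<V> A) \<phi> = models (Lambda \<V> B) \<phi>"
  using models_Lambda_mono_view_type[OF assms] models_Lambda_mono_view_type[OF assms(1,2) assms(3)[symmetric]]
  by (rule iffI)

lemma models_expand:
  "\<phi> \<in> UCV \<V> \<Longrightarrow> \<forall>V \<in> \<V>. is_view \<sigma> V \<Longrightarrow> models A (expand \<phi>) = models (Lambda \<V> A) \<phi>"
  by (simp add: models_def sat_expand)

section \<open>Sentences stating that a type is realized\<close>

definition type_literal :: "'r view set \<Rightarrow> 'r view \<Rightarrow> 'r view fo" where
  "type_literal T V = (if V \<in> T then Atom V [0] else Neg (Atom V [0]))"

text \<open>The separate last conjunct \<open>W\<close> is needed since there is no formula for the empty conjunction.\<close>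

definition type_sentence :: "'r view set \<Rightarrow> 'r view list \<Rightarrow> 'r view \<Rightarrow> 'r view fo" where
  "type_sentence T Vs W = Ex 0 (foldr (\<lambda>V. Conj (type_literal T V)) Vs (type_literal T W))"

lemma type_sentence_UCV:
  assumes "set Vs \<subseteq> \<V>" and "W \<in> \<V>"
  shows "type_sentence T Vs W \<in> UCV \<V>"
proof -
  have lit: "type_literal T V \<in> UCV \<V>" if "V \<in> \<V>" for V
    using that by (simp add: type_literal_def UCV.intros)
  have "foldr (\<lambda>V. Conj (type_literal T V)) Vs (type_literal T W) \<in> UCV \<V>"
    using assms by (induction Vs) (auto intro: UCV.intros lit)
  then show ?thesis unfolding type_sentence_def by (rule UCV.intros)
qed

lemma sentence_type_sentence: "sentence (type_sentence T Vs W)"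
proof -
  have "fv (foldr (\<lambda>V. Conj (type_literal T V)) Vs (type_literal T W)) = {0}"
    by (induction Vs) (auto simp: type_literal_def)
  then show ?thesis by (simp add: sentence_def type_sentence_def)
qed

lemma quantifier_rank_type_sentence: "quantifier_rank (type_sentence T Vs W) = 1"
proof -
  have "quantifier_rank (foldr (\<lambda>V. Conj (type_literal T V)) Vs (type_literal T W)) = 0"
    by (induction Vs) (auto simp: type_literal_def)
  then show ?thesis by (simp add: type_sentence_def)
qed

lemma models_type_sentence:
  assumes "set Vs = \<V>" and "W \<in> \<V>" and "T \<subseteq> \<V>" and "universe A \<noteq> {}"
  shows "models (Lambda \<V> A) (type_sentence T Vs W) \<longleftrightarrow> T \<in> view_type \<V> A ` universe A"
proof -
  have "sat (Lambda \<V> A) s (foldr (\<lambda>V. Conj (type_literal T V)) Vs (type_literal T W))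
      \<longleftrightarrow> T = view_type \<V> A (s 0)" if "s 0 \<in> universe A" for s
  proof -
    have lit: "sat (Lambda \<V> A) s (type_literal T V) \<longleftrightarrow> (V \<in> T \<longleftrightarrow> V \<in> view_type \<V> A (s 0))" for V
      using that by (simp add: type_literal_def interp_Lambda_view_type)
    \<comment> \<open>Stated for an arbitrary list \<open>Us\<close>, since a tail of
      \<open>Vs\<close> need no longer enumerate \<open>\<V>\<close>.\<close>
    have "sat (Lambda \<V> A) s (foldr (\<lambda>V. Conj (type_literal T V)) Us (type_literal T W))
      \<longleftrightarrow> (\<forall>V \<in> insert W (set Us). V \<in> T \<longleftrightarrow> V \<in> view_type \<V> A (s 0))" for Us
      by (induction Us) (auto simp: lit)
    \<comment> \<open>Both \<open>T\<close> and the type lie in \<open>\<V>\<close>, so agreement on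
      the views in \<open>\<V>\<close> is equality of sets.\<close>
    moreover have "view_type \<V> A (s 0) \<subseteq> \<V>" by (auto simp: view_type_def)
    ultimately show ?thesis using assms(1-3) by auto
  qed
  then have sat: "sat (Lambda \<V> A) s (type_sentence T Vs W) \<longleftrightarrow> T \<in> view_type \<V> A ` universe A" for s
    by (auto simp: type_sentence_def)
  \<comment> \<open>Truth does not depend on \<open>s\<close>, but some assignment must exist, or
    \<open>models\<close> would hold vacuously.\<close>
  obtain a where "a \<in> universe A" using assms(4) by blast
  then have "\<exists>s :: nat \<Rightarrow> _. range s \<subseteq> universe A" by (intro exI[of _ "\<lambda>_. a"]) auto
  with sat show ?thesis by (simp add: models_def)
qed

text \<open>Agreement is demanded only on sentences that are in \<open>UCV \<V>\<close> and also of
  rank 1, so either condition of the theorem supplies it; \<open>type_sentence\<close> meets both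
  restrictions.\<close>

lemma same_view_types:
  assumes "finite \<V>" and "universe A \<noteq> {}" and "universe B \<noteq> {}"
    and agree: "\<And>\<phi>. \<phi> \<in> UCV \<V> \<Longrightarrow> sentence \<phi> \<Longrightarrow> quantifier_rank \<phi> = 1 \<Longrightarrow>
      models (Lambda \<V> A) \<phi> = models (Lambda \<V> B) \<phi>"
  shows "view_type \<V> A ` universe A = view_type \<V> B ` universe B"
proof (cases "\<V> = {}")
  case True
  \<comment> \<open>Without views no \<open>type_sentence\<close> can be formed, but then the empty
    type is the only one realized on each side.\<close>
  then show ?thesis using assms(2,3) by (auto simp: view_type_def)
next
  case False
  then obtain W where W: "W \<in> \<V>" by blast
  obtain Vs where Vs: "set Vs = \<V>" using finite_list[OF assms(1)] by blast
  show ?thesis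
  proof (rule set_eqI)
    fix T
    show "T \<in> view_type \<V> A ` universe A \<longleftrightarrow> T \<in> view_type \<V> B ` universe B"
    proof (cases "T \<subseteq> \<V>")
      case True
      have "type_sentence T Vs W \<in> UCV \<V>"
        using Vs W by (intro type_sentence_UCV) auto
      note agree[OF this sentence_type_sentence quantifier_rank_type_sentence]
      then show ?thesis
        by (simp only: models_type_sentence[OF Vs W True assms(2)]
            models_type_sentence[OF Vs W True assms(3)])
    next
      case False
      \<comment> \<open>Types are subsets of \<open>\<V>\<close>, so neither side realizes
        \<open>T\<close>.\<close>
      then show ?thesis by (auto simp: view_type_def)
    qed
  qed
qed

theorem theorem7p1:
  fixes \<sigma> :: "'r vocabulary" and \<V> :: "'r view set"
    and A :: "('r, 'a) fo_structure" and B :: "('r, 'b) fo_structure"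
  assumes "finite \<V>" and "\<forall>V \<in> \<V>. is_view \<sigma> V"
    and "is_structure \<sigma> A" and "finite (universe A)"
    and "is_structure \<sigma> B" and "finite (universe B)"
  shows "(\<forall>\<phi> \<in> UCV \<V>. sentence \<phi> \<longrightarrow> models A (expand \<phi>) = models B (expand \<phi>))
    \<longleftrightarrow>
    (\<forall>\<phi>. over (view_vocabulary \<V>) \<phi> \<and> equality_free \<phi> \<and> sentence \<phi> \<and> quantifier_rank \<phi> = 1
       \<longrightarrow> models (Lambda \<V> A) \<phi> = models (Lambda \<V> B) \<phi>)"
    (is "?ucv \<longleftrightarrow> ?rank1")
proof -
  let ?same = "view_type \<V> A ` universe A = view_type \<V> B ` universe B"
  have ne: "universe A \<noteq> {}" "universe B \<noteq> {}"
    using assms(3,5) by (simp_all add: is_structure_def)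
  have expand: "models A (expand \<phi>) = models (Lambda \<V> A) \<phi>"
      "models B (expand \<phi>) = models (Lambda \<V> B) \<phi>" if "\<phi> \<in> UCV \<V>" for \<phi>
    using models_expand[OF that assms(2)] by auto
  \<comment> \<open>Here higher ranks collapse to rank 1: the rank-1 sentences in
    \<open>UCV \<V>\<close> already yield \<open>?same\<close>, which in turn preserves UCV formulas
    of every rank.\<close>
  have "?ucv \<longleftrightarrow> ?same"
  proof
    assume ?ucv
    with expand show ?same by (intro same_view_types[OF assms(1) ne]) simp
  next
    assume ?same
    then have "models (Lambda \<V> A) \<phi> = models (Lambda \<V> B) \<phi>" if "\<phi> \<in> UCV \<V>" for \<phi>
      by (rule models_Lambda_cong_view_type[OF UCV_over[OF that] UCV_equality_free[OF that]])
    with expand show ?ucv by simp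
  qed
  moreover have "?rank1 \<longleftrightarrow> ?same"
  proof
    assume ?rank1
    then show ?same
      by (intro same_view_types[OF assms(1) ne]) (simp add: UCV_over UCV_equality_free)
  next
    assume ?same
    then show ?rank1
      by (intro allI impI models_Lambda_cong_view_type) auto
  qed
  ultimately show ?thesis by simp
qed

end
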